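(* Let $k \ge 1$ be an integer and let $f(x) = \sum_{n \geq 0} q^{\binom{n+1}{2}} x^n$. Write $\dfrac{1}{f(x)^k} = \sum_{n \geq 0} u_k(n,q)\, x^n$. Then for all integers $n \ge 1$, $$u_k(n,q) = -q^n \sum_{j=0}^{n-1} (-1)^j \left\langle {n-1 \atop j} \right\rangle_q \binom{k+j}{k-1}.$$
   Context: Here $q$ is an indeterminate and $f(x)$ is regarded as a formal power series in $x$ with coefficients in $\mathbb{Z}[q]$; its constant term is $1$, so it is invertible. The $q$-binomial coefficients $\left\langle {n \atop k} \right\rangle_q \in \mathbb{Z}[q]$ (these are not the Gaussian binomial coefficients) are defined for integers $n, k \ge 0$ by $$f(x)^{k+1} = \sum_{n \geq 0} \left\langle {n+k \atop k} \right\rangle_q x^n ,$$ that is, $\left\langle {n \atop k} \right\rangle_q$ is the coefficient of $x^{n-k}$ in $f(x)^{k+1}$ for $0 \le k \le n$, and $\left\langle {n \atop k} \right\rangle_q = 0$ for $k > n$. The symbol $\binom{a}{b}$ denotes the ordinary binomial coefficient. *)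

theory Defs
  imports "HOL-Computational_Algebra.Computational_Algebra"
begin

text \<open>
  Elements of Z[q] are values of type \<^typ>\<open>int poly\<close>, the indeterminate q being \<open>[:0, 1:]\<close>;
  power series in x over Z[q] are values of type \<^typ>\<open>int poly fps\<close>.
\<close>

abbreviation q_var :: "int poly" where
  "q_var \<equiv> [:0, 1:]"

definition f_series :: "int poly fps" where
  "f_series = Abs_fps (\<lambda>n. q_var ^ ((n + 1) choose 2))"

text \<open>These are not the Gaussian binomial coefficients.\<close>

definition q_binom :: "nat \<Rightarrow> nat \<Rightarrow> int poly" where
  "q_binom n k = (if k \<le> n then (f_series ^ (k + 1)) $ (n - k) else 0)"

lemma f_series_power_eq: "f_series ^ (k + 1) = Abs_fps (\<lambda>n. q_binom (n + k) k)"
  by (simp add: fps_eq_iff q_binom_def)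

text \<open>
  The coefficient ring is not a field, so \<open>inverse\<close> is not available on \<^typ>\<open>int poly fps\<close>.
  Instead we use the library's ring-level inverse \<open>fps_right_inverse g y\<close>, whose second argument
  is the inverse of the constant term of \<open>g\<close>, here \<open>1\<close>.
\<close>

definition u_coeff :: "nat \<Rightarrow> nat \<Rightarrow> int poly" where
  "u_coeff k n = fps_right_inverse (f_series ^ k) 1 $ n"

lemma f_series_nth_0: "f_series $ 0 = 1"
  by (simp add: f_series_def binomial_eq_0)

lemma u_coeff_inverse: "f_series ^ k * Abs_fps (u_coeff k) = 1"
proof -
  have "Abs_fps (u_coeff k) = fps_right_inverse (f_series ^ k) 1"
    by (simp add: fps_eq_iff u_coeff_def)
  then show ?thesis
    by (simp add: fps_right_inverse fps_power_zeroth f_series_nth_0)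
qed

end

theory Submission
  imports Defs
begin

text \<open>
  Since \<open>f(x) = 1 + q x f(q x)\<close>, the negative binomial series gives
  \<open>1 / f(x)\<^sup>k = (\<Sum>j. (-1)\<^sup>j * ((k + j - 1) choose j) * (q x f(q x))\<^sup>j)\<close>,
  and the coefficient of \<open>x\<^sup>n\<close> in \<open>(q x f(q x))\<^sup>j\<close> is \<open>q\<^sup>n\<close> times that
  of \<open>x\<^bsup>n - j\<^esup>\<close> in \<open>f(x)\<^sup>j\<close>.
\<close>

text \<open>For \<open>k = 0\<close> the truncated subtraction makes the term at \<open>j = 0\<close> equal to \<open>0 choose 0 = 1\<close>.\<close>

definition neg_binomial_fps :: "nat \<Rightarrow> 'a :: comm_ring_1 fps" where
  "neg_binomial_fps k = Abs_fps (\<lambda>j. (-1) ^ j * of_nat ((k + j - 1) choose j))"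

lemma neg_binomial_fps_0: "neg_binomial_fps 0 = 1"
  by (auto simp: neg_binomial_fps_def fps_eq_iff binomial_eq_0)

text \<open>Pascal's rule, read off coefficientwise; the alternating sign turns the sum of
  neighbours into a difference.\<close>

lemma neg_binomial_fps_Suc: "(1 + fps_X) * neg_binomial_fps (Suc k) = neg_binomial_fps k"
proof (rule fps_ext)
  fix n
  show "((1 + fps_X) * neg_binomial_fps (Suc k)) $ n = neg_binomial_fps k $ n"
  proof (cases n)
    case (Suc m)
    then show ?thesis
      by (simp add: neg_binomial_fps_def distrib_right algebra_simps)
  qed (simp add: neg_binomial_fps_def distrib_right)
qed

lemma neg_binomial_fps_inverse: "(1 + fps_X) ^ k * neg_binomial_fps k = 1"
proof (induction k)
  case 0
  show ?case by (simp add: neg_binomial_fps_0)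
next
  case (Suc k)
  have "(1 + fps_X) ^ Suc k * neg_binomial_fps (Suc k) =
      (1 + fps_X) ^ k * ((1 + fps_X) * neg_binomial_fps (Suc k) :: 'a fps)"
    by (simp add: mult_ac)
  then show ?case
    by (simp only: neg_binomial_fps_Suc Suc.IH)
qed

text \<open>Substituting a series with zero constant term respects sums, products and
  powers.\<close>

lemma neg_binomial_fps_compose_inverse:
  fixes A :: "'a :: idom fps"
  assumes "A $ 0 = 0"
  shows "(1 + A) ^ k * (neg_binomial_fps k oo A) = 1"
proof -
  have "((1 + fps_X) ^ k * neg_binomial_fps k) oo A = (1 + A) ^ k * (neg_binomial_fps k oo A)"
    using assms
    by (simp add: fps_compose_mult_distrib fps_compose_add_distrib flip: fps_compose_power)
  then show ?thesis
    by (simp add: neg_binomial_fps_inverse)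
qed

text \<open>At \<open>x^(m+1)\<close> this is
  \<open>(m+2) choose 2 = ((m+1) choose 2) + (m+1)\<close>; the extra \<open>m+1\<close> comes from
  substituting \<open>q x\<close> for \<open>x\<close>.\<close>

lemma f_series_functional_equation:
  "f_series = 1 + (fps_X * f_series oo (fps_const q_var * fps_X))"
proof (rule fps_ext)
  fix n
  show "f_series $ n = (1 + (fps_X * f_series oo (fps_const q_var * fps_X))) $ n"
    by (cases n)
      (simp_all add: fps_compose_linear f_series_def binomial_eq_0 numeral_2_eq_2 power_add)
qed

text \<open>Both sides are inverse to \<open>f_series ^ k\<close>, a nonzero factor that cancels in
  an integral domain.\<close>

lemma u_coeff_eq_compose:
  "Abs_fps (u_coeff k) =
    neg_binomial_fps k oo (fps_X * f_series oo (fps_const q_var * fps_X))"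
proof -
  let ?A = "fps_X * f_series oo (fps_const q_var * fps_X)"
  have "f_series ^ k * (neg_binomial_fps k oo ?A) = 1"
    using neg_binomial_fps_compose_inverse[of ?A k]
    by (simp flip: f_series_functional_equation)
  moreover have "f_series ^ k \<noteq> 0"
    using f_series_nth_0 by auto
  ultimately show ?thesis
    using u_coeff_inverse[of k] by (metis mult_left_cancel)
qed

lemma shifted_f_series_power_nth:
  "(fps_X * f_series oo (fps_const q_var * fps_X)) ^ j $ n =
    (if n < j then 0 else q_var ^ n * f_series ^ j $ (n - j))"
proof -
  have "(fps_X * f_series oo (fps_const q_var * fps_X)) ^ j =
      fps_X ^ j * f_series ^ j oo (fps_const q_var * fps_X)"
    by (simp add: fps_compose_power power_mult_distrib)
  then show ?thesis
    by (simp add: fps_compose_linear fps_X_power_mult_nth)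
qed

theorem theorem2:
  fixes k n :: nat
  assumes "k \<ge> 1" and "n \<ge> 1"
  shows "u_coeff k n =
    - (q_var ^ n) * (\<Sum>j = 0..n - 1. (-1) ^ j * q_binom (n - 1) j * of_nat ((k + j) choose (k - 1)))"
proof -
  obtain m where n: "n = Suc m"
    using assms(2) by (cases n) auto
  \<comment> \<open>Symmetry applies because \<open>(k + j) - Suc j = k - 1\<close>.\<close>
  have choose: "(k + j) choose Suc j = (k + j) choose (k - 1)" for j
    using assms(1) binomial_symmetric[of "Suc j" "k + j"] by simp
  have "u_coeff k n = (\<Sum>j = 0..n. (-1) ^ j * of_nat ((k + j - 1) choose j) *
      ((fps_X * f_series oo (fps_const q_var * fps_X)) ^ j $ n))"
    using arg_cong[OF u_coeff_eq_compose[of k], of "\<lambda>g. g $ n"]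
    by (simp add: fps_compose_nth neg_binomial_fps_def)
  \<comment> \<open>The term at \<open>j = 0\<close> vanishes, since the zeroth power is 1 and
    \<open>n\<close> is positive; the other indices shift down by one.\<close>
  also have "\<dots> = (\<Sum>j = 0..m. (-1) ^ Suc j * of_nat ((k + j) choose Suc j) *
      (q_var ^ n * f_series ^ Suc j $ (m - j)))"
    unfolding n sum.atLeast0_atMost_Suc_shift
    by (simp add: shifted_f_series_power_nth f_series_nth_0 del: power_Suc)
  \<comment> \<open>For \<open>j \<le> m\<close> the coefficient of \<open>f_series ^ Suc j\<close>
    at \<open>m - j\<close> is \<open>q_binom m j\<close> by definition.\<close>
  also have "\<dots> = - (q_var ^ n) * (\<Sum>j = 0..m. (-1) ^ j * q_binom m j * of_nat ((k + j) choose (k - 1)))"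
    unfolding sum_distrib_left
    by (intro sum.cong refl) (simp add: q_binom_def choose mult_ac del: binomial_Suc_Suc)
  finally show ?thesis
    by (simp add: n)
qed

end
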